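(* Let $N\subseteq M$ be an inclusion as in Case (1) or Case (2), with Markov trace $tr$ on $M$ of modulus $\tau$, let $E_N$ be the $tr$-preserving conditional expectation of $M$ onto $N$, and let $e_1\in M_1$ be the Jones projection of the basic construction $N\subseteq M\subseteq M_1=\langle M,e_1\rangle$. Then for a finite set $\{\lambda_i : i\in I=\{1,2,\dots,n\}\}\subseteq M$, the following are equivalent: (1) The $n\times n$ matrix $Q$ whose $(i,j)$ entry is $q_{ij}=E_N(\lambda_i\lambda_j^* )$ is a projection in $M_n(N)$ such that $tr_{M_n(N)}(Q)=\tau^{-1}/n$. (2) $\sum_{i=1}^n \lambda_i^* e_1\lambda_i = 1$. (3) For every $x\in M$, $x=\sum_{i=1}^n E_N(x\lambda_i^* )\lambda_i$.
   Context: All inclusions are unital inclusions of finite von Neumann algebras with a faithful normal tracial state $tr$. For an inclusion $N\subseteq M$ with trace $tr$, $M_1=\langle M,e_1\rangle$ denotes Jones' basic construction: the von Neumann algebra on $L^2(M,tr)$ generated by $M$ and the orthogonal projection $e_1$ of $L^2(M,tr)$ onto $L^2(N,tr)$ (the Jones projection, which implements $E_N$). The trace $tr$ on $M$ is called a Markov trace of modulus $\tau$ if it extends to a positive trace $Tr$ on $M_1$ with $Tr(xe_1)=\tau\, tr(x)$ for all $x\in M$. Case (1): $N\subseteq M$ are $II_1$ factors with finite index $[M:N]<\infty$; there is a unique Markov trace $tr$ on $M$, with modulus $\tau=[M:N]^{-1}$. Case (2): $N\subseteq M$ is a connected unital inclusion of finite dimensional $C^*$-algebras (i.e. its Bratteli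 diagram is connected), with inclusion matrix $G$; there is a unique (normalized) Markov trace $tr$ on $M$, with modulus $\tau=\|G\|^{-2}$. $M_n(N)$ is the algebra of $n\times n$ matrices over $N$, with normalized trace $tr_{M_n(N)}((a_{ij}))=\frac1n\sum_i tr(a_{ii})$. A projection is a self-adjoint idempotent. The $\lambda_i$ are regarded as an indexed finite family. *)

theory Defs
  imports "HOL-Analysis.Analysis"
begin

text \<open>Complex Hilbert spaces; the inner product is linear in its first argument.\<close>

class complex_hilbert = banach +
  fixes scaleC :: "complex \<Rightarrow> 'a \<Rightarrow> 'a" (infixr "*\<^sub>C" 75)
    and cinner :: "'a \<Rightarrow> 'a \<Rightarrow> complex"
  assumes scaleC_add_right: "c *\<^sub>C (x + y) = c *\<^sub>C x + c *\<^sub>C y"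
    and scaleC_add_left: "(c + d) *\<^sub>C x = c *\<^sub>C x + d *\<^sub>C x"
    and scaleC_scaleC: "c *\<^sub>C d *\<^sub>C x = (c * d) *\<^sub>C x"
    and scaleR_scaleC: "r *\<^sub>R x = complex_of_real r *\<^sub>C x"
    and cinner_commute: "cinner x y = cnj (cinner y x)"
    and cinner_add_left: "cinner (x + y) z = cinner x z + cinner y z"
    and cinner_scaleC_left: "cinner (c *\<^sub>C x) y = c * cinner x y"
    and norm_eq_sqrt_cinner: "norm x = sqrt (Re (cinner x x))"

lemma norm_scaleC: "norm (c *\<^sub>C x) = cmod c * norm (x :: 'a::complex_hilbert)"
proof -
  have "cinner (c *\<^sub>C x) (c *\<^sub>C x) = c * cnj (cinner (c *\<^sub>C x) x)"
    by (metis cinner_commute cinner_scaleC_left)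
  also have "\<dots> = (c * cnj c) * cinner x x"
    by (metis (no_types, lifting) cinner_commute cinner_scaleC_left complex_cnj_mult mult.assoc)
  also have "\<dots> = complex_of_real ((cmod c)\<^sup>2) * cinner x x"
    by (metis complex_norm_square)
  finally have "Re (cinner (c *\<^sub>C x) (c *\<^sub>C x)) = (cmod c)\<^sup>2 * Re (cinner x x)"
    by simp
  then show ?thesis
    by (simp add: norm_eq_sqrt_cinner real_sqrt_mult)
qed

text \<open>\<^typ>\<open>'h \<Rightarrow>\<^sub>L 'h\<close> consists of the bounded \<^emph>\<open>real\<close>-linear operators; \<open>bounded_ops\<close> singles out
  the complex-linear ones, i.e. it is B(H).\<close>

type_synonym 'h op = "'h \<Rightarrow>\<^sub>L 'h"

definition bounded_ops :: "'h::complex_hilbert op set" where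
  "bounded_ops = {T :: 'h op. \<forall>c x. T (c *\<^sub>C x) = c *\<^sub>C T x}"

lift_definition op_scaleC :: "complex \<Rightarrow> 'h::complex_hilbert op \<Rightarrow> 'h op"
  is "\<lambda>c T x. c *\<^sub>C T x"
proof -
  fix c and T :: "'h \<Rightarrow> 'h"
  assume T: "bounded_linear T"
  have "bounded_linear (\<lambda>x::'h. c *\<^sub>C x)"
    by (rule bounded_linear_intro[where K = "cmod c"])
      (simp_all add: scaleC_add_right scaleR_scaleC scaleC_scaleC norm_scaleC mult.commute)
  from bounded_linear_compose[OF this T]
  show "bounded_linear (\<lambda>x. c *\<^sub>C T x)" .
qed

definition is_adjoint :: "'h::complex_hilbert op \<Rightarrow> 'h op \<Rightarrow> bool" where
  "is_adjoint T S \<longleftrightarrow> (\<forall>x y. cinner (T x) y = cinner x (S y))"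

text \<open>Every element of B(H) has a unique adjoint (Riesz).\<close>

definition adj :: "'h::complex_hilbert op \<Rightarrow> 'h op" where
  "adj T = (THE S. is_adjoint T S)"

definition positive_op :: "'h::complex_hilbert op \<Rightarrow> bool" where
  "positive_op T \<longleftrightarrow> (\<forall>x. cinner (T x) x \<in> \<real>\<^sub>\<ge>\<^sub>0)"

definition projection :: "'h::complex_hilbert op \<Rightarrow> bool" where
  "projection p \<longleftrightarrow> p \<in> bounded_ops \<and> is_adjoint p p \<and> p o\<^sub>L p = p"

definition projection_onto :: "'h::complex_hilbert op \<Rightarrow> 'h set \<Rightarrow> bool" where
  "projection_onto p S \<longleftrightarrow> projection p \<and> range (blinfun_apply p) = S"

definition commutant :: "'h::complex_hilbert op set \<Rightarrow> 'h op set" where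
  "commutant A = {T \<in> bounded_ops. \<forall>S\<in>A. T o\<^sub>L S = S o\<^sub>L T}"

definition center :: "'h::complex_hilbert op set \<Rightarrow> 'h op set" where
  "center A = A \<inter> commutant A"

definition von_neumann_algebra :: "'h::complex_hilbert op set \<Rightarrow> bool" where
  "von_neumann_algebra A \<longleftrightarrow> A \<subseteq> bounded_ops \<and> (\<forall>T\<in>A. \<exists>S\<in>A. is_adjoint T S)
     \<and> commutant (commutant A) = A"

definition linear_on :: "'h::complex_hilbert op set \<Rightarrow> ('h op \<Rightarrow> complex) \<Rightarrow> bool" where
  "linear_on A f \<longleftrightarrow> (\<forall>x\<in>A. \<forall>y\<in>A. f (x + y) = f x + f y)
     \<and> (\<forall>c. \<forall>x\<in>A. f (op_scaleC c x) = c * f x)"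

definition positive_trace :: "'h::complex_hilbert op set \<Rightarrow> ('h op \<Rightarrow> complex) \<Rightarrow> bool" where
  "positive_trace A t \<longleftrightarrow> linear_on A t \<and> (\<forall>x\<in>A. t (adj x o\<^sub>L x) \<in> \<real>\<^sub>\<ge>\<^sub>0)
     \<and> (\<forall>x\<in>A. \<forall>y\<in>A. t (x o\<^sub>L y) = t (y o\<^sub>L x))"

definition faithful_on :: "'h::complex_hilbert op set \<Rightarrow> ('h op \<Rightarrow> complex) \<Rightarrow> bool" where
  "faithful_on A t \<longleftrightarrow> (\<forall>x\<in>A. t (adj x o\<^sub>L x) = 0 \<longrightarrow> x = 0)"

text \<open>Normality: the functional preserves suprema of bounded upward directed families of
  self-adjoint elements.\<close>

definition normal_on :: "'h::complex_hilbert op set \<Rightarrow> ('h op \<Rightarrow> complex) \<Rightarrow> bool" where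
  "normal_on A t \<longleftrightarrow> (\<forall>D s. D \<noteq> {} \<and> D \<subseteq> {x \<in> A. is_adjoint x x} \<and> s \<in> A \<and> is_adjoint s s
      \<and> (\<forall>x\<in>D. \<forall>y\<in>D. \<exists>z\<in>D. positive_op (z - x) \<and> positive_op (z - y))
      \<and> (\<forall>x\<in>D. positive_op (s - x))
      \<and> (\<forall>u\<in>A. is_adjoint u u \<and> (\<forall>x\<in>D. positive_op (u - x)) \<longrightarrow> positive_op (u - s))
      \<longrightarrow> Re (t s) = (SUP x\<in>D. Re (t x)))"

definition fn_tracial_state :: "'h::complex_hilbert op set \<Rightarrow> ('h op \<Rightarrow> complex) \<Rightarrow> bool" where
  "fn_tracial_state A t \<longleftrightarrow> positive_trace A t \<and> t id_blinfun = 1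
     \<and> faithful_on A t \<and> normal_on A t"

definition finite_dimensional :: "'h::complex_hilbert op set \<Rightarrow> bool" where
  "finite_dimensional A \<longleftrightarrow> (\<exists>B. finite B \<and> A \<subseteq> span B)"

definition factor :: "'h::complex_hilbert op set \<Rightarrow> bool" where
  "factor A \<longleftrightarrow> von_neumann_algebra A \<and> center A = range (\<lambda>c. op_scaleC c id_blinfun)"

definition II1_factor :: "'h::complex_hilbert op set \<Rightarrow> bool" where
  "II1_factor A \<longleftrightarrow> factor A \<and> \<not> finite_dimensional A \<and> (\<exists>t. fn_tracial_state A t)"

definition conditional_expectation ::
  "'h::complex_hilbert op set \<Rightarrow> 'h op set \<Rightarrow> ('h op \<Rightarrow> complex) \<Rightarrow> ('h op \<Rightarrow> 'h op) \<Rightarrow> bool" where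
  "conditional_expectation N M tr E \<longleftrightarrow>
     (\<forall>x\<in>M. E x \<in> N) \<and> (\<forall>x\<in>N. E x = x)
     \<and> (\<forall>x\<in>M. \<forall>y\<in>M. E (x + y) = E x + E y)
     \<and> (\<forall>c. \<forall>x\<in>M. E (op_scaleC c x) = op_scaleC c (E x))
     \<and> (\<forall>x\<in>M. positive_op (E (adj x o\<^sub>L x)))
     \<and> (\<forall>a\<in>N. \<forall>x\<in>M. \<forall>b\<in>N. E (a o\<^sub>L x o\<^sub>L b) = a o\<^sub>L E x o\<^sub>L b)
     \<and> (\<forall>x\<in>M. tr (E x) = tr x)"

text \<open>The Hilbert space \<^typ>\<open>'k\<close> is L\<open>\<^sup>2\<close>(M,tr), the completion of M for
  \<open>\<langle>x, y\<rangle> = tr (y\<^sup>* x)\<close>: \<open>\<eta>\<close> is the canonical map of M onto a dense subspace, and \<open>lm x\<close> is the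
  operator of left multiplication by x. The subspace L\<open>\<^sup>2\<close>(N,tr) is then \<open>closure (\<eta> ` N)\<close>.\<close>

definition L2_space :: "'h::complex_hilbert op set \<Rightarrow> ('h op \<Rightarrow> complex)
    \<Rightarrow> ('h op \<Rightarrow> 'k::complex_hilbert) \<Rightarrow> ('h op \<Rightarrow> 'k op) \<Rightarrow> bool" where
  "L2_space M tr \<eta> lm \<longleftrightarrow>
     (\<forall>x\<in>M. \<forall>y\<in>M. \<eta> (x + y) = \<eta> x + \<eta> y) \<and> (\<forall>c. \<forall>x\<in>M. \<eta> (op_scaleC c x) = c *\<^sub>C \<eta> x)
     \<and> (\<forall>x\<in>M. \<forall>y\<in>M. cinner (\<eta> x) (\<eta> y) = tr (adj y o\<^sub>L x))
     \<and> closure (\<eta> ` M) = UNIV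
     \<and> (\<forall>x\<in>M. lm x \<in> bounded_ops \<and> (\<forall>y\<in>M. lm x (\<eta> y) = \<eta> (x o\<^sub>L y)))"

definition basic_construction :: "'h op set \<Rightarrow> ('h op \<Rightarrow> 'k op) \<Rightarrow> 'k op
    \<Rightarrow> 'k::complex_hilbert op set" where
  "basic_construction M lm e = von_neumann_algebra hull (insert e (lm ` M))"

definition markov_trace :: "'h op set \<Rightarrow> ('h op \<Rightarrow> complex)
    \<Rightarrow> ('h::complex_hilbert op \<Rightarrow> 'k::complex_hilbert op) \<Rightarrow> 'k op \<Rightarrow> real \<Rightarrow> bool" where
  "markov_trace M tr lm e \<tau> \<longleftrightarrow> (\<exists>Tr. positive_trace (basic_construction M lm e) Tr
     \<and> (\<forall>x\<in>M. Tr (lm x) = tr x)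
     \<and> (\<forall>x\<in>M. Tr (lm x o\<^sub>L e) = complex_of_real \<tau> * tr x))"

text \<open>For a \<open>II\<^sub>1\<close> factor A on H with finite commutant A', the coupling constant of Murray and
  von Neumann is
  \<open>dim\<^sub>A(H) = tr\<^sub>A([A'\<xi>]) / tr\<^sub>A\<^sub>'([A\<xi>])\<close> for nonzero \<open>\<xi>\<close>, where \<open>[S\<xi>]\<close> is the
  projection onto the closure of \<open>S\<xi>\<close>; it does not depend on \<open>\<xi>\<close>, and the traces are unique.
  If A' is infinite it has no faithful normal tracial state, and the dimension is infinite.\<close>

definition is_coupling_constant :: "'k::complex_hilbert op set \<Rightarrow> real \<Rightarrow> bool" where
  "is_coupling_constant A c \<longleftrightarrow> (\<exists>t t' \<xi> p q. fn_tracial_state A t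
     \<and> fn_tracial_state (commutant A) t' \<and> \<xi> \<noteq> 0
     \<and> p \<in> A \<and> projection_onto p (closure {blinfun_apply T \<xi> |T. T \<in> commutant A})
     \<and> q \<in> commutant A \<and> projection_onto q (closure {blinfun_apply T \<xi> |T. T \<in> A})
     \<and> c = Re (t p) / Re (t' q))"

text \<open>The Jones index [M:N] is \<open>dim\<^sub>N(L\<^sup>2(M,tr))\<close>, with N acting by left multiplication.\<close>

definition finite_index :: "'h op set \<Rightarrow> ('h::complex_hilbert op \<Rightarrow> 'k::complex_hilbert op) \<Rightarrow> bool" where
  "finite_index N lm \<longleftrightarrow> (\<exists>c. is_coupling_constant (lm ` N) c)"

definition jones_index :: "'h op set \<Rightarrow> ('h::complex_hilbert op \<Rightarrow> 'k::complex_hilbert op) \<Rightarrow> real" where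
  "jones_index N lm = (SOME c. is_coupling_constant (lm ` N) c)"

definition case_1 :: "'h op set \<Rightarrow> 'h op set
    \<Rightarrow> ('h::complex_hilbert op \<Rightarrow> 'k::complex_hilbert op) \<Rightarrow> real \<Rightarrow> bool" where
  "case_1 N M lm \<tau> \<longleftrightarrow> II1_factor N \<and> II1_factor M \<and> finite_index N lm
     \<and> \<tau> = 1 / jones_index N lm"

definition minimal_projection :: "'h::complex_hilbert op set \<Rightarrow> 'h op \<Rightarrow> bool" where
  "minimal_projection A f \<longleftrightarrow> f \<in> A \<and> projection f \<and> f \<noteq> 0
     \<and> (\<forall>g\<in>A. projection g \<and> g o\<^sub>L f = g \<longrightarrow> g = 0 \<or> g = f)"

text \<open>The simple summands of N and M are cut out by the minimal central projections
  \<open>p\<^sub>0, \<dots>, p\<^sub>r\<^sub>-\<^sub>1\<close> and \<open>q\<^sub>0, \<dots>, q\<^sub>s\<^sub>-\<^sub>1\<close>. The multiplicity \<open>G i j\<close> of \<open>N p\<^sub>i\<close> in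
  \<open>M q\<^sub>j\<close> is the rank in the matrix algebra \<open>M q\<^sub>j\<close> of \<open>f q\<^sub>j\<close>, for f a minimal projection of
  \<open>N p\<^sub>i\<close>.\<close>

definition inclusion_matrix ::
  "'h::complex_hilbert op set \<Rightarrow> 'h op set \<Rightarrow> nat \<Rightarrow> nat \<Rightarrow> (nat \<Rightarrow> nat \<Rightarrow> nat) \<Rightarrow> bool" where
  "inclusion_matrix N M r s G \<longleftrightarrow> 0 < r \<and> 0 < s \<and> (\<exists>p q.
     bij_betw p {..<r} {z. minimal_projection (center N) z}
     \<and> bij_betw q {..<s} {z. minimal_projection (center M) z}
     \<and> (\<forall>i<r. \<forall>j<s. \<exists>f F. minimal_projection N f \<and> f o\<^sub>L p i = f
          \<and> finite F \<and> (\<forall>g\<in>F. minimal_projection M g)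
          \<and> (\<forall>g\<in>F. \<forall>h\<in>F. g \<noteq> h \<longrightarrow> g o\<^sub>L h = 0)
          \<and> \<Sum>F = f o\<^sub>L q j \<and> G i j = card F))"

text \<open>The Bratteli diagram is bipartite, with \<open>G i j\<close> edges joining \<open>Inl i\<close> and \<open>Inr j\<close>.\<close>

definition bratteli_connected :: "nat \<Rightarrow> nat \<Rightarrow> (nat \<Rightarrow> nat \<Rightarrow> nat) \<Rightarrow> bool" where
  "bratteli_connected r s G \<longleftrightarrow>
     (let V = Inl ` {..<r} \<union> Inr ` {..<s};
          R = {(Inl i, Inr j) |i j. i < r \<and> j < s \<and> G i j \<noteq> 0}
      in \<forall>u\<in>V. \<forall>v\<in>V. (u, v) \<in> (R \<union> R\<inverse>)\<^sup>*)"

definition matrix_norm :: "nat \<Rightarrow> nat \<Rightarrow> (nat \<Rightarrow> nat \<Rightarrow> nat) \<Rightarrow> real" where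
  "matrix_norm r s G = (SUP v\<in>{v. L2_set v {..<s} \<le> 1}.
     L2_set (\<lambda>i. \<Sum>j<s. real (G i j) * v j) {..<r})"

definition case_2 :: "'h::complex_hilbert op set \<Rightarrow> 'h op set \<Rightarrow> real \<Rightarrow> bool" where
  "case_2 N M \<tau> \<longleftrightarrow> finite_dimensional N \<and> finite_dimensional M
     \<and> (\<exists>r s G. inclusion_matrix N M r s G \<and> bratteli_connected r s G
          \<and> \<tau> = 1 / (matrix_norm r s G)\<^sup>2)"

text \<open>Matrices over an operator algebra are indexed by \<open>{1..n}\<close>; entries outside are irrelevant.\<close>

definition matrix_projection ::
  "nat \<Rightarrow> 'h::complex_hilbert op set \<Rightarrow> (nat \<Rightarrow> nat \<Rightarrow> 'h op) \<Rightarrow> bool" where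
  "matrix_projection n N Q \<longleftrightarrow> (\<forall>i\<in>{1..n}. \<forall>j\<in>{1..n}.
     Q i j \<in> N \<and> adj (Q j i) = Q i j \<and> (\<Sum>k=1..n. Q i k o\<^sub>L Q k j) = Q i j)"

definition matrix_trace ::
  "nat \<Rightarrow> ('h::complex_hilbert op \<Rightarrow> complex) \<Rightarrow> (nat \<Rightarrow> nat \<Rightarrow> 'h op) \<Rightarrow> complex" where
  "matrix_trace n tr Q = (\<Sum>i=1..n. tr (Q i i)) / of_nat n"

end

theory Submission
  imports Defs
begin

text \<open>Let T be the frame operator \<open>\<Sum> \<lambda>\<^sub>i\<^sup>* e\<^sub>1 \<lambda>\<^sub>i\<close>; it acts on M by \<open>\<theta> x = \<Sum> \<lambda>\<^sub>i\<^sup>* E (\<lambda>\<^sub>i x)\<close>, so T = 1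
  means \<open>\<theta> x = x\<close>, which is (3) for the adjoint of x. Evaluating the Markov trace at T = 1 gives
  the trace of Q. Conversely, if Q is idempotent then the self-adjoint T satisfies \<open>T\<^sup>3 = T\<^sup>2\<close>,
  hence p = 1 - T is a projection, and the trace condition says Tr p = 0. Faithfulness of Tr on the
  basic construction is not needed: Cauchy--Schwarz gives Tr (p z) = 0 for all z, and since
  \<open>p x e\<^sub>1 = d e\<^sub>1\<close> with \<open>d = x - \<theta> x\<close>, we get \<open>\<tau> tr (d\<^sup>* d) = Tr (d\<^sup>* p x e\<^sub>1) = 0\<close>, so
  d = 0. Cases (1) and (2) enter only through \<open>\<tau> \<noteq> 0\<close>.\<close>

section \<open>Complex inner products and adjoints\<close>

lemma cinner_add_right: "cinner (x::'a::complex_hilbert) (y + z) = cinner x y + cinner x z"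
  by (metis cinner_add_left cinner_commute complex_cnj_add)

lemma cinner_scaleC_right: "cinner (x::'a::complex_hilbert) (c *\<^sub>C y) = cnj c * cinner x y"
  by (metis cinner_scaleC_left cinner_commute complex_cnj_mult)

lemma scaleC_minus1: "(-1) *\<^sub>C (x::'a::complex_hilbert) = - x"
  using scaleR_scaleC[of "-1" x] by simp

lemma cinner_minus_left: "cinner (- x) (y::'a::complex_hilbert) = - cinner x y"
  using cinner_scaleC_left[of "-1" x y] by (simp add: scaleC_minus1)

lemma cinner_diff_left: "cinner (x - z) (y::'a::complex_hilbert) = cinner x y - cinner z y"
  using cinner_add_left[of x "- z" y] by (simp add: cinner_minus_left)

lemma cinner_diff_right: "cinner (y::'a::complex_hilbert) (x - z) = cinner y x - cinner y z"
  by (metis cinner_diff_left cinner_commute complex_cnj_diff)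

lemma cinner_zero_left [simp]: "cinner 0 (y::'a::complex_hilbert) = 0"
  using cinner_diff_left[of 0 0 y] by simp

lemma cinner_zero_right [simp]: "cinner (y::'a::complex_hilbert) 0 = 0"
  using cinner_diff_right[of y 0 0] by simp

lemma cinner_self_eq_0_iff [simp]: "cinner x x = 0 \<longleftrightarrow> (x::'a::complex_hilbert) = 0"
  using norm_eq_sqrt_cinner[of x] by auto

lemma cinner_eqI:
  assumes "\<And>z. cinner z x = cinner z (y::'a::complex_hilbert)"
  shows "x = y"
  using assms[of "x - y"] cinner_diff_right[of "x - y" x y] cinner_self_eq_0_iff[of "x - y"] by simp

lemma norm_add_power2: "(norm (x + y :: 'a::complex_hilbert))\<^sup>2 = (norm x)\<^sup>2 + (norm y)\<^sup>2 + 2 * Re (cinner x y)"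
proof -
  have n: "(norm z)\<^sup>2 = Re (cinner z z)" for z :: 'a
    using norm_eq_sqrt_cinner[of z] norm_ge_zero[of z] by simp
  have "Re (cinner y x) = Re (cinner x y)"
    by (subst cinner_commute) simp
  then show ?thesis
    by (simp add: n cinner_add_left cinner_add_right)
qed

text \<open>Expresses the inner product through norms alone, so that its joint continuity reduces to
  that of the norm. The factor \<open>\<i>\<close> in the second slot turns the imaginary part into
  a real part.\<close>

lemma cinner_polarization:
  "cinner x (y::'a::complex_hilbert) =
     Complex (((norm (x + y))\<^sup>2 - (norm x)\<^sup>2 - (norm y)\<^sup>2) / 2)
       (((norm (x + \<i> *\<^sub>C y))\<^sup>2 - (norm x)\<^sup>2 - (norm y)\<^sup>2) / 2)"
  by (simp add: complex_eq_iff norm_add_power2 norm_scaleC cinner_scaleC_right)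

lemma bounded_linear_scaleC: "bounded_linear (\<lambda>x::'a::complex_hilbert. c *\<^sub>C x)"
  by (rule bounded_linear_intro[where K = "cmod c"])
    (simp_all add: scaleC_add_right scaleR_scaleC scaleC_scaleC norm_scaleC mult.commute)

lemma continuous_on_cinner:
  assumes "continuous_on S f" "continuous_on S (g :: _ \<Rightarrow> 'a::complex_hilbert)"
  shows "continuous_on S (\<lambda>x. cinner (f x) (g x))"
proof -
  have *: "continuous_on S (\<lambda>x. \<i> *\<^sub>C g x)"
    using bounded_linear.continuous_on[OF bounded_linear_scaleC assms(2)] .
  show ?thesis
    unfolding cinner_polarization Complex_eq by (intro continuous_intros assms *) auto
qed

lemma cinner_eq_on_closure:
  assumes "x \<in> closure S" "continuous_on UNIV f" "continuous_on UNIV (g :: 'a::complex_hilbert \<Rightarrow> complex)"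
    and "\<And>y. y \<in> S \<Longrightarrow> f y = g y"
  shows "f x = g x"
proof -
  have "closed {x. f x = g x}"
    using assms(2,3) by (intro closed_Collect_eq)
  then have "closure S \<subseteq> {x. f x = g x}"
    using assms(4) by (intro closure_minimal) auto
  then show ?thesis
    using assms(1) by auto
qed

lemma blinfun_eqI_dense:
  assumes "closure S = UNIV" "\<And>v. v \<in> S \<Longrightarrow> blinfun_apply F v = blinfun_apply G v"
  shows "F = G"
proof (rule blinfun_eqI)
  fix x
  have "closed {x. blinfun_apply F x = blinfun_apply G x}"
    by (intro closed_Collect_eq continuous_intros)
  then have "closure S \<subseteq> {x. blinfun_apply F x = blinfun_apply G x}"
    using assms(2) by (intro closure_minimal) auto
  then show "blinfun_apply F x = blinfun_apply G x"
    using assms(1) by auto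
qed

text \<open>Both sides are continuous in each variable, so the identity extends first in the right
  argument, with the left one kept in S, and then in the left argument.\<close>

lemma is_adjoint_dense:
  assumes "closure S = UNIV"
    and "\<And>u v. u \<in> S \<Longrightarrow> v \<in> S \<Longrightarrow> cinner (blinfun_apply F u) v = cinner u (blinfun_apply G v)"
  shows "is_adjoint F G"
  unfolding is_adjoint_def
proof (intro allI)
  fix x y
  have c: "continuous_on UNIV (blinfun_apply F)" "continuous_on UNIV (blinfun_apply G)"
    by (intro continuous_intros)+
  have dense_left: "cinner (blinfun_apply F u) y = cinner u (blinfun_apply G y)" if "u \<in> S" for u
    by (rule cinner_eq_on_closure[of y S "\<lambda>y. cinner (blinfun_apply F u) y"
          "\<lambda>y. cinner u (blinfun_apply G y)"])
      (use assms that in \<open>auto intro!: continuous_on_cinner c continuous_on_id continuous_on_const\<close>)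
  show "cinner (blinfun_apply F x) y = cinner x (blinfun_apply G y)"
    by (rule cinner_eq_on_closure[of x S "\<lambda>x. cinner (blinfun_apply F x) y"
          "\<lambda>x. cinner x (blinfun_apply G y)"])
      (use assms(1) dense_left in
        \<open>auto intro!: continuous_on_cinner c continuous_on_id continuous_on_const\<close>)
qed

text \<open>As \<open>adj\<close> is a definite description, its value is always read off from a
  witness. Uniqueness holds because inner products separate vectors.\<close>

lemma adj_eqI: "is_adjoint T S \<Longrightarrow> adj T = S"
  unfolding adj_def
proof (rule the_equality)
  fix S' assume "is_adjoint T S" "is_adjoint T S'"
  then show "S' = S"
    unfolding is_adjoint_def by (metis blinfun_eqI cinner_eqI)
qed

lemma is_adjoint_sym: "is_adjoint T S \<Longrightarrow> is_adjoint S T"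
  unfolding is_adjoint_def by (metis cinner_commute)

lemma is_adjoint_id: "is_adjoint id_blinfun id_blinfun"
  by (simp add: is_adjoint_def)

lemma is_adjoint_add: "is_adjoint T S \<Longrightarrow> is_adjoint T' S' \<Longrightarrow> is_adjoint (T + T') (S + S')"
  by (simp add: is_adjoint_def blinfun.add_left cinner_add_left cinner_add_right)

lemma is_adjoint_compose: "is_adjoint T S \<Longrightarrow> is_adjoint T' S' \<Longrightarrow> is_adjoint (T o\<^sub>L T') (S' o\<^sub>L S)"
  by (simp add: is_adjoint_def)

lemma is_adjoint_scaleC: "is_adjoint T S \<Longrightarrow> is_adjoint (op_scaleC c T) (op_scaleC (cnj c) S)"
  by (simp add: is_adjoint_def op_scaleC.rep_eq cinner_scaleC_left cinner_scaleC_right)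

text \<open>The squared norm of \<open>S x\<close> is the inner product of x with
  \<open>S (S x)\<close>.\<close>

lemma self_adjoint_square_zero:
  assumes "is_adjoint S S" "S o\<^sub>L S = 0"
  shows "S = 0"
proof (rule blinfun_eqI)
  fix x
  have "cinner (S x) (S x) = cinner x ((S o\<^sub>L S) x)"
    using assms(1) by (simp add: is_adjoint_def)
  then show "S x = blinfun_apply 0 x"
    using assms(2) by simp
qed

lemma projection_onto_apply:
  assumes "projection_onto p S" "v \<in> S"
  shows "blinfun_apply p v = v"
proof -
  have "v \<in> range (blinfun_apply p)" "p o\<^sub>L p = p"
    using assms by (auto simp: projection_onto_def projection_def)
  then show ?thesis
    by (metis blinfun_apply_blinfun_compose imageE)
qed

section \<open>Star algebras of operators\<close>

lemmas compose_distrib =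
  bounded_bilinear.add_left[OF bounded_bilinear_blinfun_compose]
  bounded_bilinear.add_right[OF bounded_bilinear_blinfun_compose]
  bounded_bilinear.diff_left[OF bounded_bilinear_blinfun_compose]
  bounded_bilinear.diff_right[OF bounded_bilinear_blinfun_compose]

lemmas compose_sum_left = bounded_bilinear.sum_left[OF bounded_bilinear_blinfun_compose]
lemmas compose_sum_right = bounded_bilinear.sum_right[OF bounded_bilinear_blinfun_compose]

lemma blinfun_compose_assoc: "(x o\<^sub>L y) o\<^sub>L z = x o\<^sub>L (y o\<^sub>L z)"
  by (auto intro!: blinfun_eqI)

lemma compose_id [simp]: "id_blinfun o\<^sub>L x = x" "x o\<^sub>L id_blinfun = x"
  by (auto intro!: blinfun_eqI)

lemma op_scaleC_compose_left: "op_scaleC c x o\<^sub>L y = op_scaleC c (x o\<^sub>L y)"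
  by (auto intro!: blinfun_eqI simp: op_scaleC.rep_eq)

lemma op_scaleC_compose_right:
  "x \<in> bounded_ops \<Longrightarrow> x o\<^sub>L op_scaleC c y = op_scaleC c (x o\<^sub>L y)"
  by (auto intro!: blinfun_eqI simp: op_scaleC.rep_eq bounded_ops_def)

lemma op_scaleC_simps [simp]:
  "op_scaleC 0 x = 0" "op_scaleC 1 x = x" "op_scaleC (-1) x = - x"
proof -
  have "0 *\<^sub>C y = 0" "1 *\<^sub>C y = y" for y :: 'a
    using scaleR_scaleC[of 0 y] scaleR_scaleC[of 1 y] by simp_all
  then show "op_scaleC 0 x = 0" "op_scaleC 1 x = x" "op_scaleC (-1) x = - x"
    by (auto intro!: blinfun_eqI simp: op_scaleC.rep_eq scaleC_minus1 blinfun.minus_left)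
qed

lemma op_scaleC_scaleC: "op_scaleC c (op_scaleC d x) = op_scaleC (c * d) x"
  by (auto intro!: blinfun_eqI simp: op_scaleC.rep_eq scaleC_scaleC)

lemma scaleC_commute: "c *\<^sub>C d *\<^sub>C x = d *\<^sub>C c *\<^sub>C (x::'a::complex_hilbert)"
  by (simp add: scaleC_scaleC mult.commute)

lemma bounded_ops_closed:
  "id_blinfun \<in> bounded_ops"
  "x \<in> bounded_ops \<Longrightarrow> y \<in> bounded_ops \<Longrightarrow> x + y \<in> bounded_ops"
  "x \<in> bounded_ops \<Longrightarrow> y \<in> bounded_ops \<Longrightarrow> x o\<^sub>L y \<in> bounded_ops"
  "x \<in> bounded_ops \<Longrightarrow> op_scaleC c x \<in> bounded_ops"
  by (auto simp: bounded_ops_def blinfun.add_left scaleC_add_right op_scaleC.rep_eq scaleC_commute)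

text \<open>The operator type only guarantees real linearity; an adjoint relation forces complex
  linearity of y through sesquilinearity of the inner product.\<close>

lemma adjoint_in_bounded_ops:
  assumes "is_adjoint x y"
  shows "y \<in> bounded_ops"
  unfolding bounded_ops_def
proof (intro CollectI allI)
  fix c v
  have a: "cinner z (blinfun_apply y w) = cinner (blinfun_apply x z) w" for z w
    using assms by (simp add: is_adjoint_def)
  show "blinfun_apply y (c *\<^sub>C v) = c *\<^sub>C blinfun_apply y v"
    by (rule cinner_eqI) (simp add: a cinner_scaleC_right)
qed

text \<open>The algebraic content of a von Neumann algebra, with no closure condition. The clause
  \<open>is_adjoint x (adj x)\<close> is explicit because \<open>adj x\<close> is an unspecified
  value when x has no adjoint.\<close>

definition star_algebra :: "'h::complex_hilbert op set \<Rightarrow> bool" where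
  "star_algebra A \<longleftrightarrow> A \<subseteq> bounded_ops \<and> id_blinfun \<in> A
     \<and> (\<forall>x\<in>A. \<forall>y\<in>A. x + y \<in> A \<and> x o\<^sub>L y \<in> A) \<and> (\<forall>c. \<forall>x\<in>A. op_scaleC c x \<in> A)
     \<and> (\<forall>x\<in>A. is_adjoint x (adj x) \<and> adj x \<in> A)"

context
  fixes A :: "'h::complex_hilbert op set"
  assumes A: "star_algebra A"
begin

lemma star_algebra_bounded_ops: "x \<in> A \<Longrightarrow> x \<in> bounded_ops"
  and star_algebra_id: "id_blinfun \<in> A"
  and star_algebra_add: "x \<in> A \<Longrightarrow> y \<in> A \<Longrightarrow> x + y \<in> A"
  and star_algebra_compose: "x \<in> A \<Longrightarrow> y \<in> A \<Longrightarrow> x o\<^sub>L y \<in> A"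
  and star_algebra_scaleC: "x \<in> A \<Longrightarrow> op_scaleC c x \<in> A"
  and star_algebra_adj: "x \<in> A \<Longrightarrow> adj x \<in> A"
  and star_algebra_is_adjoint: "x \<in> A \<Longrightarrow> is_adjoint x (adj x)"
  using A by (auto simp: star_algebra_def)

lemma star_algebra_zero: "0 \<in> A"
  using star_algebra_scaleC[OF star_algebra_id, of 0] by simp

lemma star_algebra_minus: "x \<in> A \<Longrightarrow> - x \<in> A"
  using star_algebra_scaleC[of x "-1"] by simp

lemma star_algebra_diff: "x \<in> A \<Longrightarrow> y \<in> A \<Longrightarrow> x - y \<in> A"
  using star_algebra_add[of x "- y"] star_algebra_minus[of y] by simp

lemma star_algebra_sum: "(\<And>i. i \<in> I \<Longrightarrow> x i \<in> A) \<Longrightarrow> (\<Sum>i\<in>I. x i) \<in> A"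
  by (induction I rule: infinite_finite_induct) (auto simp: star_algebra_zero star_algebra_add)

lemma star_algebra_adj_adj: "x \<in> A \<Longrightarrow> adj (adj x) = x"
  by (rule adj_eqI[OF is_adjoint_sym[OF star_algebra_is_adjoint]])

lemma star_algebra_adj_compose: "x \<in> A \<Longrightarrow> y \<in> A \<Longrightarrow> adj (x o\<^sub>L y) = adj y o\<^sub>L adj x"
  by (intro adj_eqI is_adjoint_compose star_algebra_is_adjoint)

lemma star_algebra_adj_add: "x \<in> A \<Longrightarrow> y \<in> A \<Longrightarrow> adj (x + y) = adj x + adj y"
  by (intro adj_eqI is_adjoint_add star_algebra_is_adjoint)

lemma star_algebra_adj_scaleC: "x \<in> A \<Longrightarrow> adj (op_scaleC c x) = op_scaleC (cnj c) (adj x)"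
  by (intro adj_eqI is_adjoint_scaleC star_algebra_is_adjoint)

lemma star_algebra_adj_sum:
  "(\<And>i. i \<in> I \<Longrightarrow> x i \<in> A) \<Longrightarrow> adj (\<Sum>i\<in>I. x i) = (\<Sum>i\<in>I. adj (x i))"
proof (induction I rule: infinite_finite_induct)
  case (insert i I)
  then show ?case
    by (simp add: star_algebra_adj_add star_algebra_sum)
qed (auto intro!: adj_eqI simp: is_adjoint_def)

end

lemmas star_algebra_closed =
  star_algebra_id star_algebra_zero star_algebra_add star_algebra_compose star_algebra_scaleC
  star_algebra_adj star_algebra_minus star_algebra_diff star_algebra_sum

section \<open>Commutants, von Neumann algebras and their hull\<close>

lemma commutant_closed:
  assumes "x \<in> commutant C" "y \<in> commutant C" "C \<subseteq> bounded_ops"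
  shows "id_blinfun \<in> commutant C" "x + y \<in> commutant C" "x o\<^sub>L y \<in> commutant C"
    "op_scaleC c x \<in> commutant C"
proof -
  show "id_blinfun \<in> commutant C" "x + y \<in> commutant C"
    using assms by (auto simp: commutant_def bounded_ops_closed compose_distrib)
  show "op_scaleC c x \<in> commutant C"
    using assms by (auto simp: commutant_def bounded_ops_closed op_scaleC_compose_left
        op_scaleC_compose_right subset_iff)
  show "x o\<^sub>L y \<in> commutant C"
  proof -
    have "(x o\<^sub>L y) o\<^sub>L S = S o\<^sub>L (x o\<^sub>L y)" if "S \<in> C" for S
    proof -
      have "x o\<^sub>L S = S o\<^sub>L x" "y o\<^sub>L S = S o\<^sub>L y"
        using assms(1,2) that by (auto simp: commutant_def)
      then show ?thesis
        by (metis blinfun_compose_assoc)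
    qed
    then show ?thesis
      using assms by (auto simp: commutant_def bounded_ops_closed)
  qed
qed

text \<open>The double commutant condition writes A as a commutant, and commutants of sets of
  complex-linear operators are unital algebras; adjoints come from the definition.\<close>

lemma von_neumann_algebra_imp_star_algebra:
  assumes "von_neumann_algebra A"
  shows "star_algebra A"
proof -
  have A: "A \<subseteq> bounded_ops" "\<And>T. T \<in> A \<Longrightarrow> \<exists>S\<in>A. is_adjoint T S" "commutant (commutant A) = A"
    using assms by (auto simp: von_neumann_algebra_def)
  have c: "commutant A \<subseteq> bounded_ops"
    by (auto simp: commutant_def)
  have "id_blinfun \<in> commutant (commutant A)"
    by (auto simp: commutant_def bounded_ops_closed)
  moreover have "is_adjoint x (adj x) \<and> adj x \<in> A" if "x \<in> A" for x
    using A(2)[OF that] adj_eqI by metis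
  ultimately show ?thesis
    unfolding star_algebra_def
    using A(1) commutant_closed[where C = "commutant A", unfolded A(3), OF _ _ c] A(3) by auto
qed

text \<open>If no von Neumann algebra contains S, the hull is the whole type, and so is not a star
  algebra: hence the subalgebra B.\<close>

lemma star_algebra_in_hull:
  assumes "\<And>x. x \<in> S \<Longrightarrow> x \<in> bounded_ops \<and> (\<exists>y. is_adjoint x y)"
  obtains B where "star_algebra B" "S \<subseteq> B" "B \<subseteq> von_neumann_algebra hull S"
proof -
  let ?H = "von_neumann_algebra hull S"
  define B where "B = {x \<in> ?H. x \<in> bounded_ops \<and> (\<exists>y. is_adjoint x y)}"
  have H: "x \<in> ?H \<longleftrightarrow> (\<forall>T. von_neumann_algebra T \<longrightarrow> S \<subseteq> T \<longrightarrow> x \<in> T)" for x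
    by (auto simp: hull_def)
  note v = von_neumann_algebra_imp_star_algebra
  have "B \<subseteq> bounded_ops"
    by (auto simp: B_def)
  moreover have "x + y \<in> B" "x o\<^sub>L y \<in> B" if "x \<in> B" "y \<in> B" for x y
    using that by (auto simp: B_def H v star_algebra_closed bounded_ops_closed
        intro: is_adjoint_add is_adjoint_compose)
  moreover have "op_scaleC c x \<in> B" if "x \<in> B" for x c
    using that by (auto simp: B_def H v star_algebra_closed bounded_ops_closed intro: is_adjoint_scaleC)
  moreover have "id_blinfun \<in> B"
    by (auto simp: B_def H v star_algebra_closed bounded_ops_closed intro: is_adjoint_id)
  moreover have "is_adjoint x (adj x) \<and> adj x \<in> B" if x: "x \<in> B" for x
  proof -
    obtain y where y: "is_adjoint x y"
      using x by (auto simp: B_def)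
    then have "adj x = y"
      by (rule adj_eqI)
    \<comment> \<open>Every von Neumann algebra containing S contains x and therefore
      \<open>adj x\<close>, so the adjoint stays in the hull.\<close>
    then show ?thesis
      using y x star_algebra_adj[OF v, of _ x] is_adjoint_sym[OF y] adjoint_in_bounded_ops[OF y]
      by (auto simp: B_def H)
  qed
  ultimately have "star_algebra B"
    by (simp add: star_algebra_def)
  moreover have "S \<subseteq> B" "B \<subseteq> ?H"
    using assms by (auto simp: B_def intro: hull_inc)
  ultimately show thesis
    by (rule that)
qed

section \<open>Positive traces\<close>

context
  fixes A :: "'h::complex_hilbert op set" and f :: "'h op \<Rightarrow> complex"
  assumes A: "star_algebra A" and f: "positive_trace A f"
begin

lemma trace_add: "x \<in> A \<Longrightarrow> y \<in> A \<Longrightarrow> f (x + y) = f x + f y"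
  and trace_scaleC: "x \<in> A \<Longrightarrow> f (op_scaleC c x) = c * f x"
  and trace_pos: "x \<in> A \<Longrightarrow> f (adj x o\<^sub>L x) \<in> \<real>\<^sub>\<ge>\<^sub>0"
  and trace_commute: "x \<in> A \<Longrightarrow> y \<in> A \<Longrightarrow> f (x o\<^sub>L y) = f (y o\<^sub>L x)"
  using f by (auto simp: positive_trace_def linear_on_def)

lemma trace_zero: "f 0 = 0"
  using trace_scaleC[OF star_algebra_id[OF A], of 0] by simp

lemma trace_diff: "x \<in> A \<Longrightarrow> y \<in> A \<Longrightarrow> f (x - y) = f x - f y"
  using trace_add[of x "op_scaleC (-1) y"] trace_scaleC[of y "-1"] star_algebra_scaleC[OF A, of y "-1"]
  by simp

lemma trace_sum: "(\<And>i. i \<in> I \<Longrightarrow> x i \<in> A) \<Longrightarrow> f (\<Sum>i\<in>I. x i) = (\<Sum>i\<in>I. f (x i))"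
  by (induction I rule: infinite_finite_induct)
    (auto simp: trace_zero trace_add star_algebra_sum[OF A])

text \<open>This is the positivity of f at \<open>y + op_scaleC s x\<close>, expanded. Suitable
  choices of the scalar s give both the Cauchy--Schwarz argument and the hermitian property.\<close>

lemma trace_sesquilinear_pos:
  assumes "x \<in> A" "y \<in> A"
  shows "f (adj y o\<^sub>L y) + s * f (adj y o\<^sub>L x) + cnj s * f (adj x o\<^sub>L y)
    + (cnj s * s) * f (adj x o\<^sub>L x) \<in> \<real>\<^sub>\<ge>\<^sub>0"
proof -
  note cl = assms star_algebra_closed[OF A]
  have "adj (y + op_scaleC s x) o\<^sub>L (y + op_scaleC s x)
    = (adj y o\<^sub>L y) + op_scaleC s (adj y o\<^sub>L x) + op_scaleC (cnj s) (adj x o\<^sub>L y)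
      + op_scaleC (cnj s * s) (adj x o\<^sub>L x)"
    by (simp add: cl star_algebra_adj_add[OF A] star_algebra_adj_scaleC[OF A] compose_distrib
        op_scaleC_compose_left op_scaleC_compose_right star_algebra_bounded_ops[OF A] op_scaleC_scaleC)
  then have "f (adj (y + op_scaleC s x) o\<^sub>L (y + op_scaleC s x))
    = f (adj y o\<^sub>L y) + s * f (adj y o\<^sub>L x) + cnj s * f (adj x o\<^sub>L y)
      + (cnj s * s) * f (adj x o\<^sub>L x)"
    by (simp only: trace_add trace_scaleC cl)
  then show ?thesis
    using trace_pos[of "y + op_scaleC s x"] cl by simp
qed

text \<open>The degenerate case of the Cauchy--Schwarz inequality.\<close>

lemma trace_null_vector:
  assumes "x \<in> A" "y \<in> A" "f (adj x o\<^sub>L x) = 0"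
  shows "f (adj x o\<^sub>L y) = 0"
proof -
  define K \<beta> \<gamma> where "K = f (adj y o\<^sub>L y)" "\<beta> = f (adj y o\<^sub>L x)" "\<gamma> = f (adj x o\<^sub>L y)"
  have pos: "K + s * \<beta> + cnj s * \<gamma> \<in> \<real>\<^sub>\<ge>\<^sub>0" for s
    using trace_sesquilinear_pos[OF assms(1,2), of s] assms(3) by (simp add: K_\<beta>_\<gamma>_def)
  \<comment> \<open>An affine function of a real variable that is real and nonnegative everywhere
    has slope zero.\<close>
  have lin: "w = 0" if "\<And>t::real. K + of_real t * w \<in> \<real>\<^sub>\<ge>\<^sub>0" for w
  proof -
    have K: "Im K = 0" "0 \<le> Re K"
      using that[of 0] by (auto simp: complex_nonneg_Reals_iff)
    have Im: "Im w = 0"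
      using that[of 1] K by (auto simp: complex_nonneg_Reals_iff)
    have "Re w = 0"
    proof (rule ccontr)
      assume "Re w \<noteq> 0"
      moreover have "0 \<le> Re K + t * Re w" for t
        using that[of t] by (auto simp: complex_nonneg_Reals_iff)
      \<comment> \<open>At this t the affine function takes the value -1.\<close>
      from this[of "- (Re K + 1) / Re w"] show False
        using \<open>Re w \<noteq> 0\<close> by simp
    qed
    with Im show ?thesis
      by (simp add: complex_eq_iff)
  qed
  \<comment> \<open>Real s gives the slope \<beta> + \<gamma>, purely imaginary s the slope
    \<open>\<i> * \<beta> - \<i> * \<gamma>\<close>; both vanish, hence so does \<gamma>.\<close>
  have "\<beta> + \<gamma> = 0"
    using pos[of "of_real _"] by (intro lin) (simp add: algebra_simps)
  moreover have "\<i> * \<beta> - \<i> * \<gamma> = 0"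
    using pos[of "of_real _ * \<i>"] by (intro lin) (simp add: algebra_simps)
  ultimately show ?thesis
    by (simp add: K_\<beta>_\<gamma>_def)
qed

lemma trace_adj:
  assumes "x \<in> A"
  shows "f (adj x) = cnj (f x)"
proof -
  have i: "adj id_blinfun = id_blinfun"
    by (rule adj_eqI[OF is_adjoint_id])
  have pos: "f (adj x o\<^sub>L x) \<in> \<real>\<^sub>\<ge>\<^sub>0" "f id_blinfun \<in> \<real>\<^sub>\<ge>\<^sub>0"
    using trace_pos[OF assms] trace_pos[OF star_algebra_id[OF A]] by (simp_all add: i)
  have "f (adj x o\<^sub>L x) + s * f (adj x) + cnj s * f x + (cnj s * s) * f id_blinfun \<in> \<real>\<^sub>\<ge>\<^sub>0" for s
    using trace_sesquilinear_pos[OF star_algebra_id[OF A] assms, of s] by (simp add: i)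
  \<comment> \<open>All these values are real: s = 1 makes the imaginary parts of
    \<open>f (adj x)\<close> and \<open>f x\<close> opposite, and s = \<i> makes the real parts
    equal.\<close>
  from this[of 1] this[of \<i>] show ?thesis
    using pos by (auto simp: complex_nonneg_Reals_iff complex_eq_iff)
qed

end

lemma positive_trace_mono: "positive_trace A f \<Longrightarrow> B \<subseteq> A \<Longrightarrow> positive_trace B f"
  unfolding positive_trace_def linear_on_def by blast

section \<open>The Jones projection\<close>

locale jones_projection =
  fixes M N :: "'h::complex_hilbert op set"
    and tr :: "'h op \<Rightarrow> complex"
    and E :: "'h op \<Rightarrow> 'h op"
    and \<eta> :: "'h op \<Rightarrow> 'k::complex_hilbert"
    and lm :: "'h op \<Rightarrow> 'k op"
    and e :: "'k op"
  assumes M: "star_algebra M" and N: "star_algebra N" and N_subset_M: "N \<subseteq> M"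
    and tr: "positive_trace M tr" and tr_id: "tr id_blinfun = 1" and faithful: "faithful_on M tr"
    and L2: "L2_space M tr \<eta> lm"
    and e_onto: "projection_onto e (closure (\<eta> ` N))"
    and cond_exp: "conditional_expectation N M tr E"
begin

lemmas M_closed = star_algebra_closed[OF M]
lemmas N_closed = star_algebra_closed[OF N]

lemma in_M: "x \<in> N \<Longrightarrow> x \<in> M"
  using N_subset_M by auto

section \<open>The conditional expectation\<close>

lemma E_in_N: "x \<in> M \<Longrightarrow> E x \<in> N"
  and E_fix: "x \<in> N \<Longrightarrow> E x = x"
  and E_add: "x \<in> M \<Longrightarrow> y \<in> M \<Longrightarrow> E (x + y) = E x + E y"
  and E_bimodule: "a \<in> N \<Longrightarrow> x \<in> M \<Longrightarrow> b \<in> N \<Longrightarrow> E (a o\<^sub>L x o\<^sub>L b) = a o\<^sub>L E x o\<^sub>L b"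
  and tr_E: "x \<in> M \<Longrightarrow> tr (E x) = tr x"
  using cond_exp by (auto simp: conditional_expectation_def)

lemma E_in_M: "x \<in> M \<Longrightarrow> E x \<in> M"
  using E_in_N in_M by auto

lemma E_left: "a \<in> N \<Longrightarrow> x \<in> M \<Longrightarrow> E (a o\<^sub>L x) = a o\<^sub>L E x"
  using E_bimodule[of a x id_blinfun] N_closed(1) by simp

lemma E_right: "x \<in> M \<Longrightarrow> b \<in> N \<Longrightarrow> E (x o\<^sub>L b) = E x o\<^sub>L b"
  using E_bimodule[of id_blinfun x b] N_closed(1) by simp

lemma E_sum: "(\<And>i. i \<in> I \<Longrightarrow> x i \<in> M) \<Longrightarrow> E (\<Sum>i\<in>I. x i) = (\<Sum>i\<in>I. E (x i))"
  by (induction I rule: infinite_finite_induct)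
    (auto simp: E_fix[OF N_closed(2)] E_add M_closed)

lemma tr_faithful: "x \<in> M \<Longrightarrow> tr (adj x o\<^sub>L x) = 0 \<Longrightarrow> x = 0"
  using faithful by (auto simp: faithful_on_def)

text \<open>Compatibility with adjoints is not an axiom of \<open>conditional_expectation\<close>.
  It follows because both sides have the same trace pairing with every element of N and tr is
  faithful.\<close>

lemma E_adj:
  assumes x: "x \<in> M"
  shows "E (adj x) = adj (E x)"
proof -
  have tr_eq: "tr (b o\<^sub>L E (adj x)) = tr (b o\<^sub>L adj (E x))" if b: "b \<in> N" for b
  proof -
    note m = x b E_in_M E_in_N in_M M_closed N_closed
    have "tr (b o\<^sub>L E (adj x)) = tr (b o\<^sub>L adj x)"
      by (metis E_left tr_E m(1,2) in_M star_algebra_adj[OF M] star_algebra_compose[OF M])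
    also have "b o\<^sub>L adj x = adj (x o\<^sub>L adj b)"
      by (simp add: star_algebra_adj_compose[OF M] star_algebra_adj_adj[OF M] m)
    also have "tr \<dots> = cnj (tr (x o\<^sub>L adj b))"
      by (rule trace_adj[OF M tr]) (simp add: m)
    also have "tr (x o\<^sub>L adj b) = tr (E x o\<^sub>L adj b)"
      by (metis E_right tr_E m(1,2) in_M star_algebra_adj[OF N] star_algebra_compose[OF M])
    also have "cnj \<dots> = tr (adj (E x o\<^sub>L adj b))"
      by (rule trace_adj[OF M tr, symmetric]) (simp add: m)
    also have "adj (E x o\<^sub>L adj b) = b o\<^sub>L adj (E x)"
      by (simp add: star_algebra_adj_compose[OF M] star_algebra_adj_adj[OF M] m)
    finally show ?thesis .
  qed
  \<comment> \<open>The difference lies in N, so its own adjoint may serve as the test element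
    b.\<close>
  define d where "d = E (adj x) - adj (E x)"
  note m = x E_in_N in_M M_closed N_closed
  have d: "d \<in> N"
    unfolding d_def by (simp add: m)
  have "tr (adj d o\<^sub>L d) = tr (adj d o\<^sub>L E (adj x)) - tr (adj d o\<^sub>L adj (E x))"
    using d by (subst (2) d_def) (simp add: compose_distrib trace_diff[OF M tr] m)
  also have "\<dots> = 0"
    using tr_eq[of "adj d"] d by (simp add: m)
  finally have "d = 0"
    using tr_faithful d in_M by blast
  then show ?thesis
    by (simp add: d_def)
qed

section \<open>The representation of M on its \<open>L\<^sup>2\<close> space\<close>

lemma \<eta>_add: "x \<in> M \<Longrightarrow> y \<in> M \<Longrightarrow> \<eta> (x + y) = \<eta> x + \<eta> y"
  and \<eta>_scaleC: "x \<in> M \<Longrightarrow> \<eta> (op_scaleC c x) = c *\<^sub>C \<eta> x"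
  and \<eta>_inner: "x \<in> M \<Longrightarrow> y \<in> M \<Longrightarrow> cinner (\<eta> x) (\<eta> y) = tr (adj y o\<^sub>L x)"
  and \<eta>_dense: "closure (\<eta> ` M) = UNIV"
  and lm_bounded_ops: "x \<in> M \<Longrightarrow> lm x \<in> bounded_ops"
  and lm_\<eta>: "x \<in> M \<Longrightarrow> y \<in> M \<Longrightarrow> blinfun_apply (lm x) (\<eta> y) = \<eta> (x o\<^sub>L y)"
  using L2 by (auto simp: L2_space_def)

lemma \<eta>_zero: "\<eta> 0 = 0"
  using \<eta>_add[of 0 0] M_closed by simp

lemma \<eta>_diff: "x \<in> M \<Longrightarrow> y \<in> M \<Longrightarrow> \<eta> (x - y) = \<eta> x - \<eta> y"
  using \<eta>_add[of x "- y"] \<eta>_scaleC[of y "-1"] M_closed by (simp add: scaleC_minus1)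

lemma \<eta>_sum: "(\<And>i. i \<in> I \<Longrightarrow> x i \<in> M) \<Longrightarrow> \<eta> (\<Sum>i\<in>I. x i) = (\<Sum>i\<in>I. \<eta> (x i))"
  by (induction I rule: infinite_finite_induct) (auto simp: \<eta>_zero \<eta>_add M_closed)

lemma \<eta>_inj:
  assumes "x \<in> M" "y \<in> M" "\<eta> x = \<eta> y"
  shows "x = y"
proof -
  have "tr (adj (x - y) o\<^sub>L (x - y)) = cinner (\<eta> (x - y)) (\<eta> (x - y))"
    using assms M_closed by (simp add: \<eta>_inner)
  also have "\<dots> = 0"
    using assms by (simp add: \<eta>_diff)
  finally show ?thesis
    using tr_faithful[of "x - y"] assms M_closed by simp
qed

text \<open>Reduces identities between operators to computations with elements of M, by density of
  its image.\<close>

lemma op_eqI: "(\<And>x. x \<in> M \<Longrightarrow> blinfun_apply F (\<eta> x) = blinfun_apply G (\<eta> x)) \<Longrightarrow> F = G"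
  using blinfun_eqI_dense[OF \<eta>_dense] by blast

lemma lm_compose: "x \<in> M \<Longrightarrow> y \<in> M \<Longrightarrow> lm (x o\<^sub>L y) = lm x o\<^sub>L lm y"
  by (rule op_eqI) (simp add: lm_\<eta> M_closed blinfun_compose_assoc)

lemma lm_id: "lm id_blinfun = id_blinfun"
  by (rule op_eqI) (simp add: lm_\<eta> M_closed)

lemma is_adjoint_lm:
  assumes "x \<in> M"
  shows "is_adjoint (lm x) (lm (adj x))"
  by (rule is_adjoint_dense[OF \<eta>_dense])
    (use assms in \<open>auto simp: lm_\<eta> \<eta>_inner M_closed star_algebra_adj_compose[OF M]
      star_algebra_adj_adj[OF M] blinfun_compose_assoc\<close>)

lemma is_adjoint_e: "is_adjoint e e"
  and e_bounded_ops: "e \<in> bounded_ops"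
  and e_idem: "e o\<^sub>L e = e"
  using e_onto by (auto simp: projection_onto_def projection_def)

text \<open>The Jones projection is given only by its range; this shows that it implements E. The
  vector \<open>\<eta> x - \<eta> (E x)\<close> is orthogonal to that range and hence killed, while
  \<open>\<eta> (E x)\<close> lies in it and is fixed.\<close>

lemma e_\<eta>:
  assumes x: "x \<in> M"
  shows "blinfun_apply e (\<eta> x) = \<eta> (E x)"
proof -
  note m = x in_M E_in_N M_closed N_closed
  define v where "v = \<eta> x - \<eta> (E x)"
  have v_orth: "cinner v w = 0" if "w \<in> closure (\<eta> ` N)" for w
  proof (rule cinner_eq_on_closure[OF that, of "cinner v" "\<lambda>_. 0"])
    fix y assume "y \<in> \<eta> ` N"
    then obtain b where b: "b \<in> N" "y = \<eta> b" by auto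
    have "tr (adj b o\<^sub>L x) = tr (adj b o\<^sub>L E x)"
      using tr_E[of "adj b o\<^sub>L x"] by (simp add: E_left m b)
    then show "cinner v y = 0"
      by (simp add: v_def cinner_diff_left \<eta>_inner m b)
  qed (auto intro!: continuous_on_cinner continuous_on_id continuous_on_const)
  have range_e: "blinfun_apply e v \<in> closure (\<eta> ` N)"
    using e_onto by (auto simp: projection_onto_def)
  \<comment> \<open>Self-adjointness and idempotence turn the squared norm of \<open>e v\<close>
    into the inner product of v with \<open>e v\<close>, a vector of the range.\<close>
  have "cinner (blinfun_apply e v) (blinfun_apply e v) = cinner v (blinfun_apply (e o\<^sub>L e) v)"
    using is_adjoint_e by (simp add: is_adjoint_def)
  also have "\<dots> = 0"
    using v_orth[OF range_e] by (simp add: e_idem)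
  finally have "blinfun_apply e v = 0"
    by simp
  moreover have "blinfun_apply e (\<eta> (E x)) = \<eta> (E x)"
    using projection_onto_apply[OF e_onto] closure_subset E_in_N[OF x] by blast
  ultimately show ?thesis
    by (simp add: v_def blinfun.diff_right)
qed

section \<open>The frame operator and the Gram matrix Q\<close>

definition frame_op :: "'i set \<Rightarrow> ('i \<Rightarrow> 'h op) \<Rightarrow> 'k op" where
  "frame_op I l = (\<Sum>i\<in>I. lm (adj (l i)) o\<^sub>L e o\<^sub>L lm (l i))"

definition frame_map :: "'i set \<Rightarrow> ('i \<Rightarrow> 'h op) \<Rightarrow> 'h op \<Rightarrow> 'h op" where
  "frame_map I l x = (\<Sum>i\<in>I. adj (l i) o\<^sub>L E (l i o\<^sub>L x))"

context
  fixes I :: "'i set" and l :: "'i \<Rightarrow> 'h op"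
  assumes l: "\<And>i. i \<in> I \<Longrightarrow> l i \<in> M"
begin

lemma frame_map_in_M: "x \<in> M \<Longrightarrow> frame_map I l x \<in> M"
  unfolding frame_map_def by (auto intro!: M_closed E_in_M l)

lemma frame_op_\<eta>: "x \<in> M \<Longrightarrow> blinfun_apply (frame_op I l) (\<eta> x) = \<eta> (frame_map I l x)"
  unfolding frame_op_def frame_map_def
  by (subst \<eta>_sum) (auto simp: blinfun.sum_left lm_\<eta> e_\<eta> M_closed l E_in_M)

text \<open>Injectivity of \<eta> gives one direction, density of its image the other.\<close>

lemma frame_op_id_iff_frame_map:
  "frame_op I l = id_blinfun \<longleftrightarrow> (\<forall>x\<in>M. frame_map I l x = x)"
proof
  assume "frame_op I l = id_blinfun"
  then show "\<forall>x\<in>M. frame_map I l x = x"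
    using frame_op_\<eta> \<eta>_inj frame_map_in_M by (metis blinfun_apply_id_blinfun id_apply)
qed (auto intro!: op_eqI simp: frame_op_\<eta>)

lemma adj_frame_map:
  assumes x: "x \<in> M"
  shows "adj (frame_map I l x) = (\<Sum>i\<in>I. E (adj x o\<^sub>L adj (l i)) o\<^sub>L l i)"
  unfolding frame_map_def
  by (subst star_algebra_adj_sum[OF M])
    (auto intro!: sum.cong simp: x l M_closed E_in_M star_algebra_adj_compose[OF M]
      star_algebra_adj_adj[OF M] E_adj[symmetric])

text \<open>The expansion has its coefficients on the left, \<open>frame_map\<close> on the right;
  taking adjoints and replacing x by \<open>adj x\<close> exchanges the two.\<close>

lemma frame_op_id_iff_expansion:
  "frame_op I l = id_blinfun \<longleftrightarrow> (\<forall>x\<in>M. x = (\<Sum>i\<in>I. E (x o\<^sub>L adj (l i)) o\<^sub>L l i))"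
  unfolding frame_op_id_iff_frame_map
proof safe
  fix x assume fixed: "\<forall>x\<in>M. frame_map I l x = x" and x: "x \<in> M"
  have "adj (frame_map I l (adj x)) = x"
    using fixed x M_closed(6) by (simp add: star_algebra_adj_adj[OF M])
  then show "x = (\<Sum>i\<in>I. E (x o\<^sub>L adj (l i)) o\<^sub>L l i)"
    using adj_frame_map[of "adj x"] x M_closed(6) by (simp add: star_algebra_adj_adj[OF M])
next
  fix x assume expansion: "\<forall>x\<in>M. x = (\<Sum>i\<in>I. E (x o\<^sub>L adj (l i)) o\<^sub>L l i)" and x: "x \<in> M"
  have "adj (frame_map I l x) = adj x"
    unfolding adj_frame_map[OF x] using bspec[OF expansion M_closed(6)[OF x]] by simp
  then have "adj (adj (frame_map I l x)) = adj (adj x)"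
    by simp
  then show "frame_map I l x = x"
    by (simp add: star_algebra_adj_adj[OF M] x frame_map_in_M)
qed

lemma is_adjoint_frame_op: "is_adjoint (frame_op I l) (frame_op I l)"
proof -
  have "is_adjoint (lm (adj (l i)) o\<^sub>L e o\<^sub>L lm (l i)) (lm (adj (l i)) o\<^sub>L e o\<^sub>L lm (l i))" if "i \<in> I" for i
    using is_adjoint_compose[OF is_adjoint_compose[OF is_adjoint_sym[OF is_adjoint_lm] is_adjoint_e]
        is_adjoint_lm] l[OF that] by (simp add: blinfun_compose_assoc)
  then show ?thesis
    unfolding frame_op_def is_adjoint_def blinfun.sum_left
    by (induction I rule: infinite_finite_induct) (auto simp: cinner_add_left cinner_add_right)
qed

lemma gram_in_N: "i \<in> I \<Longrightarrow> j \<in> I \<Longrightarrow> E (l i o\<^sub>L adj (l j)) \<in> N"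
  by (intro E_in_N M_closed l)

lemma gram_adj: "i \<in> I \<Longrightarrow> j \<in> I \<Longrightarrow> adj (E (l j o\<^sub>L adj (l i))) = E (l i o\<^sub>L adj (l j))"
  by (simp add: l M_closed E_adj[symmetric] star_algebra_adj_compose[OF M] star_algebra_adj_adj[OF M])

text \<open>Expand \<open>adj (l j)\<close> by the frame map, multiply by \<open>l i\<close> on the
  left and apply E: right N-linearity of E produces the entries of Q squared.\<close>

lemma gram_idempotent:
  assumes "frame_op I l = id_blinfun" "i \<in> I" "j \<in> I"
  shows "(\<Sum>k\<in>I. E (l i o\<^sub>L adj (l k)) o\<^sub>L E (l k o\<^sub>L adj (l j))) = E (l i o\<^sub>L adj (l j))"
proof -
  have "adj (l j) = frame_map I l (adj (l j))"
    using assms l by (simp add: frame_op_id_iff_frame_map M_closed)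
  then have "E (l i o\<^sub>L adj (l j)) = E (l i o\<^sub>L frame_map I l (adj (l j)))"
    by simp
  also have "l i o\<^sub>L frame_map I l (adj (l j)) = (\<Sum>k\<in>I. l i o\<^sub>L (adj (l k) o\<^sub>L E (l k o\<^sub>L adj (l j))))"
    by (simp add: frame_map_def compose_sum_right)
  also have "E \<dots> = (\<Sum>k\<in>I. E (l i o\<^sub>L (adj (l k) o\<^sub>L E (l k o\<^sub>L adj (l j)))))"
    using assms l by (intro E_sum M_closed E_in_M) auto
  also have "\<dots> = (\<Sum>k\<in>I. E (l i o\<^sub>L adj (l k)) o\<^sub>L E (l k o\<^sub>L adj (l j)))"
    using assms l
    by (intro sum.cong refl) (simp add: blinfun_compose_assoc[symmetric] E_right E_in_N M_closed)
  finally show ?thesis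
    by simp
qed

text \<open>With \<open>y\<^sub>i = E (l i o x)\<close>, the frame map turns the column \<open>y\<close> into \<open>Q y\<close>, and
  \<open>frame_map x\<close> depends on x only through \<open>y\<close>.\<close>

lemma frame_op_cube:
  assumes Q: "\<And>i j. i \<in> I \<Longrightarrow> j \<in> I \<Longrightarrow>
      (\<Sum>k\<in>I. E (l i o\<^sub>L adj (l k)) o\<^sub>L E (l k o\<^sub>L adj (l j))) = E (l i o\<^sub>L adj (l j))"
  shows "frame_op I l o\<^sub>L frame_op I l o\<^sub>L frame_op I l = frame_op I l o\<^sub>L frame_op I l"
proof (rule op_eqI)
  fix x assume x: "x \<in> M"
  let ?\<theta> = "frame_map I l" and ?Q = "\<lambda>i j. E (l i o\<^sub>L adj (l j))"
  have column: "E (l i o\<^sub>L ?\<theta> z) = (\<Sum>j\<in>I. ?Q i j o\<^sub>L E (l j o\<^sub>L z))" if "i \<in> I" "z \<in> M" for i z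
  proof -
    have "E (l i o\<^sub>L ?\<theta> z) = (\<Sum>j\<in>I. E (l i o\<^sub>L (adj (l j) o\<^sub>L E (l j o\<^sub>L z))))"
      using that l unfolding frame_map_def compose_sum_right
      by (intro E_sum M_closed E_in_M) auto
    also have "\<dots> = (\<Sum>j\<in>I. ?Q i j o\<^sub>L E (l j o\<^sub>L z))"
      using that l
      by (intro sum.cong refl) (simp add: blinfun_compose_assoc[symmetric] E_right E_in_N M_closed)
    finally show ?thesis .
  qed
  \<comment> \<open>In terms of the column y of x this reads Q (Q y) = Q y.\<close>
  have "E (l i o\<^sub>L ?\<theta> (?\<theta> x)) = E (l i o\<^sub>L ?\<theta> x)" if i: "i \<in> I" for i
  proof -
    have "E (l i o\<^sub>L ?\<theta> (?\<theta> x)) = (\<Sum>j\<in>I. ?Q i j o\<^sub>L (\<Sum>k\<in>I. ?Q j k o\<^sub>L E (l k o\<^sub>L x)))"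
      using i by (simp add: column x frame_map_in_M)
    also have "\<dots> = (\<Sum>k\<in>I. (\<Sum>j\<in>I. ?Q i j o\<^sub>L ?Q j k) o\<^sub>L E (l k o\<^sub>L x))"
      by (simp only: compose_sum_right compose_sum_left blinfun_compose_assoc) (rule sum.swap)
    also have "\<dots> = (\<Sum>k\<in>I. ?Q i k o\<^sub>L E (l k o\<^sub>L x))"
      using i by (simp add: Q)
    finally show ?thesis
      using i by (simp add: column x)
  qed
  \<comment> \<open>Unfolding only the outermost \<theta> on each side leaves sums that depend on
    the two columns just shown to be equal.\<close>
  then have "?\<theta> (?\<theta> (?\<theta> x)) = ?\<theta> (?\<theta> x)"
    by (subst (1 4) frame_map_def) (simp cong: sum.cong)
  then show "blinfun_apply (frame_op I l o\<^sub>L frame_op I l o\<^sub>L frame_op I l) (\<eta> x)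
      = blinfun_apply (frame_op I l o\<^sub>L frame_op I l) (\<eta> x)"
    by (simp add: frame_op_\<eta> frame_map_in_M x)
qed

text \<open>For S = T T - T the cubic relation makes the fourth, third and second powers of T
  coincide, so S S = 0. Being self-adjoint, S vanishes.\<close>

lemma frame_op_idempotent:
  assumes "\<And>i j. i \<in> I \<Longrightarrow> j \<in> I \<Longrightarrow>
      (\<Sum>k\<in>I. E (l i o\<^sub>L adj (l k)) o\<^sub>L E (l k o\<^sub>L adj (l j))) = E (l i o\<^sub>L adj (l j))"
  shows "frame_op I l o\<^sub>L frame_op I l = frame_op I l"
proof -
  let ?T = "frame_op I l"
  let ?S = "(?T o\<^sub>L ?T) - ?T"
  have "is_adjoint ?S ?S"
    using is_adjoint_frame_op
    by (simp add: is_adjoint_def blinfun.diff_left cinner_diff_left cinner_diff_right)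
  moreover have "?S o\<^sub>L ?S = 0"
    using frame_op_cube[OF assms] by (simp add: compose_distrib blinfun_compose_assoc)
  ultimately show ?thesis
    using self_adjoint_square_zero by fastforce
qed

text \<open>After e only vectors \<open>\<eta> (E y)\<close> occur, and \<open>frame_map\<close>
  commutes with right multiplication by N. So the complement of the frame operator, applied to M e,
  gives elements of M e again, where the Markov property applies.\<close>

lemma frame_op_lm_e:
  assumes x: "x \<in> M"
  shows "(id_blinfun - frame_op I l) o\<^sub>L lm x o\<^sub>L e = lm (x - frame_map I l x) o\<^sub>L e"
proof (rule op_eqI)
  fix y assume y: "y \<in> M"
  note m = x y E_in_M E_in_N M_closed frame_map_in_M
  have "frame_map I l (x o\<^sub>L E y) = frame_map I l x o\<^sub>L E y"
    unfolding frame_map_def compose_sum_left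
    using l by (intro sum.cong refl) (simp add: blinfun_compose_assoc[symmetric] E_right m)
  then show "blinfun_apply ((id_blinfun - frame_op I l) o\<^sub>L lm x o\<^sub>L e) (\<eta> y)
      = blinfun_apply (lm (x - frame_map I l x) o\<^sub>L e) (\<eta> y)"
    by (simp add: m e_\<eta> lm_\<eta> blinfun.diff_left frame_op_\<eta> compose_distrib \<eta>_diff)
qed

end

end

text \<open>B is any star algebra that contains the generators and carries the trace; in the final
  proof it is a subalgebra of the basic construction.\<close>

locale jones_markov = jones_projection M N tr E \<eta> lm e
  for M N :: "'h::complex_hilbert op set" and tr E
    and \<eta> :: "'h op \<Rightarrow> 'k::complex_hilbert" and lm e +
  fixes \<tau> :: real and B :: "'k op set" and Tr :: "'k op \<Rightarrow> complex"
  assumes B: "star_algebra B" and generators: "insert e (lm ` M) \<subseteq> B"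
    and Tr: "positive_trace B Tr"
    and Tr_lm: "\<And>x. x \<in> M \<Longrightarrow> Tr (lm x) = tr x"
    and Tr_lm_e: "\<And>x. x \<in> M \<Longrightarrow> Tr (lm x o\<^sub>L e) = complex_of_real \<tau> * tr x"
begin

lemmas B_closed = star_algebra_closed[OF B]

lemma e_in_B: "e \<in> B" and lm_in_B: "x \<in> M \<Longrightarrow> lm x \<in> B"
  using generators by auto

lemma Tr_id: "Tr id_blinfun = 1"
  using Tr_lm[OF M_closed(1)] by (simp add: lm_id tr_id)

context
  fixes I :: "'i set" and l :: "'i \<Rightarrow> 'h op"
  assumes l: "\<And>i. i \<in> I \<Longrightarrow> l i \<in> M"
begin

lemma frame_op_in_B: "frame_op I l \<in> B"
  unfolding frame_op_def by (intro B_closed lm_in_B e_in_B M_closed l)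

text \<open>Cyclicity moves \<open>lm (l i)\<close> to the front of each summand, where the Markov
  property evaluates it; \<open>tr_E\<close> then inserts E.\<close>

lemma Tr_frame_op: "Tr (frame_op I l) = complex_of_real \<tau> * (\<Sum>i\<in>I. tr (E (l i o\<^sub>L adj (l i))))"
proof -
  have "Tr (lm (adj (l i)) o\<^sub>L e o\<^sub>L lm (l i)) = complex_of_real \<tau> * tr (E (l i o\<^sub>L adj (l i)))"
    if "i \<in> I" for i
  proof -
    note m = l[OF that] lm_in_B e_in_B M_closed B_closed
    have "Tr ((lm (adj (l i)) o\<^sub>L e) o\<^sub>L lm (l i)) = Tr (lm (l i) o\<^sub>L (lm (adj (l i)) o\<^sub>L e))"
      by (rule trace_commute[OF B Tr]) (simp_all add: m)
    also have "lm (l i) o\<^sub>L (lm (adj (l i)) o\<^sub>L e) = lm (l i o\<^sub>L adj (l i)) o\<^sub>L e"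
      by (simp add: lm_compose m blinfun_compose_assoc)
    finally show ?thesis
      by (simp add: Tr_lm_e m tr_E)
  qed
  then show ?thesis
    unfolding frame_op_def
    by (subst trace_sum[OF B Tr]) (auto simp: sum_distrib_left B_closed lm_in_B e_in_B M_closed l)
qed

lemma frame_op_eq_id:
  assumes "\<tau> \<noteq> 0"
    and Q: "\<And>i j. i \<in> I \<Longrightarrow> j \<in> I \<Longrightarrow>
      (\<Sum>k\<in>I. E (l i o\<^sub>L adj (l k)) o\<^sub>L E (l k o\<^sub>L adj (l j))) = E (l i o\<^sub>L adj (l j))"
    and trQ: "complex_of_real \<tau> * (\<Sum>i\<in>I. tr (E (l i o\<^sub>L adj (l i)))) = 1"
  shows "frame_op I l = id_blinfun"
proof -
  define p where "p = id_blinfun - frame_op I l"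
  have p: "p \<in> B"
    unfolding p_def by (intro B_closed frame_op_in_B)
  have adj_p: "adj p = p"
    using is_adjoint_frame_op[where I = I and l = l] l unfolding p_def
    by (intro adj_eqI)
      (simp add: is_adjoint_def blinfun.diff_left cinner_diff_left cinner_diff_right)
  have "p o\<^sub>L p = p"
    unfolding p_def using frame_op_idempotent[of I l, OF l Q] by (simp add: compose_distrib)
  moreover have "Tr p = 0"
    unfolding p_def
    by (simp add: trace_diff[OF B Tr] frame_op_in_B B_closed Tr_id Tr_frame_op trQ)
  \<comment> \<open>As p is a self-adjoint idempotent, \<open>Tr (adj p o\<^sub>L p)\<close> is
    \<open>Tr p\<close> = 0, so p is a null vector.\<close>
  ultimately have Tr_p: "Tr (p o\<^sub>L z) = 0" if "z \<in> B" for z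
    using trace_null_vector[OF B Tr p that] by (simp add: adj_p)
  have "frame_map I l x = x" if x: "x \<in> M" for x
  proof -
    define d where "d = x - frame_map I l x"
    have d: "d \<in> M"
      unfolding d_def by (intro M_closed(8) frame_map_in_M l x)
    note m = x d p lm_in_B e_in_B M_closed B_closed
    \<comment> \<open>The Markov property turns the squared 2-norm of d into a value of
      \<open>Tr\<close>, which cyclicity brings to the form
      \<open>Tr (p o\<^sub>L z)\<close>.\<close>
    have "complex_of_real \<tau> * tr (adj d o\<^sub>L d) = Tr (lm (adj d) o\<^sub>L (lm d o\<^sub>L e))"
      using Tr_lm_e[of "adj d o\<^sub>L d"] by (simp add: m lm_compose blinfun_compose_assoc)
    also have "lm d o\<^sub>L e = p o\<^sub>L (lm x o\<^sub>L e)"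
      unfolding d_def p_def using frame_op_lm_e[of I l, OF l x] by (simp add: blinfun_compose_assoc)
    also have "Tr (lm (adj d) o\<^sub>L (p o\<^sub>L (lm x o\<^sub>L e))) = Tr (p o\<^sub>L ((lm x o\<^sub>L e) o\<^sub>L lm (adj d)))"
      by (subst trace_commute[OF B Tr]) (simp_all add: m blinfun_compose_assoc)
    also have "\<dots> = 0"
      by (rule Tr_p) (simp add: m)
    finally have "d = 0"
      using \<open>\<tau> \<noteq> 0\<close> tr_faithful[OF d] by simp
    then show ?thesis
      by (simp add: d_def)
  qed
  then show ?thesis
    using frame_op_id_iff_frame_map[of I l] l by blast
qed

end

end

section \<open>The modulus is nonzero\<close>

text \<open>Both projections fix the nonzero vector \<xi>, so faithfulness keeps both traces away
  from 0. The denominator matters too, since division by zero yields 0.\<close>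

lemma coupling_constant_nonzero:
  assumes c: "is_coupling_constant A c" and id: "id_blinfun \<in> A"
  shows "c \<noteq> 0"
proof -
  obtain t t' \<xi> p q where *: "fn_tracial_state A t" "fn_tracial_state (commutant A) t'" "\<xi> \<noteq> 0"
    "p \<in> A" "projection_onto p (closure {blinfun_apply T \<xi> |T. T \<in> commutant A})"
    "q \<in> commutant A" "projection_onto q (closure {blinfun_apply T \<xi> |T. T \<in> A})"
    "c = Re (t p) / Re (t' q)"
    using c unfolding is_coupling_constant_def by blast
  have "id_blinfun \<in> commutant A"
    by (auto simp: commutant_def bounded_ops_closed)
  \<comment> \<open>The identity operator puts \<xi> into its own orbit under A and under the
    commutant.\<close>
  then have mem: "\<xi> \<in> {blinfun_apply T \<xi> |T. T \<in> commutant A}" "\<xi> \<in> {blinfun_apply T \<xi> |T. T \<in> A}"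
    using id by (force intro!: exI[of _ id_blinfun])+
  have nz: "Re (s r) \<noteq> 0"
    if s: "fn_tracial_state C s" "r \<in> C" and r: "projection_onto r (closure S)" and \<xi>: "\<xi> \<in> S"
    for C s r S
  proof -
    have "blinfun_apply r \<xi> = \<xi>"
      using projection_onto_apply[OF r] \<xi> closure_subset by blast
    then have "r \<noteq> 0"
      using \<open>\<xi> \<noteq> 0\<close> by auto
    moreover have "adj r o\<^sub>L r = r"
      using r adj_eqI[of r r] by (auto simp: projection_onto_def projection_def)
    ultimately have "s r \<noteq> 0" "s r \<in> \<real>\<^sub>\<ge>\<^sub>0"
      using s unfolding fn_tracial_state_def faithful_on_def positive_trace_def by metis+
    then show ?thesis
      by (auto simp: complex_nonneg_Reals_iff complex_eq_iff)
  qed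
  show ?thesis
    using nz[OF *(1,4,5) mem(1)] nz[OF *(2,6,7) mem(2)] *(8) by simp
qed

text \<open>The j-th unit vector is mapped to a vector whose i-th coordinate is
  \<open>G i j\<close>.\<close>

lemma matrix_norm_pos:
  assumes i: "i < r" and j: "j < s" and G: "G i j \<noteq> 0"
  shows "0 < matrix_norm r s G"
proof -
  define v :: "nat \<Rightarrow> real" where "v = (\<lambda>k. if k = j then 1 else 0)"
  define F where "F = (\<lambda>v. L2_set (\<lambda>i. \<Sum>j<s. real (G i j) * v j) {..<r})"
  have "(\<Sum>k<s. (v k)\<^sup>2) = (\<Sum>k<s. if k = j then 1 else 0)"
    by (intro sum.cong) (auto simp: v_def)
  then have v: "L2_set v {..<s} \<le> 1"
    using j by (simp add: L2_set_def)
  have "0 < real (G i j)"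
    using G by simp
  also have "real (G i j) = (\<Sum>k<s. real (G i k) * v k)"
    using j by (simp add: v_def if_distrib[of "(*) _"] cong: if_cong)
  also have "\<dots> \<le> F v"
    unfolding F_def using i by (intro member_le_L2_set) auto
  finally have "0 < F v" .
  also have "F v \<le> (SUP v\<in>{v. L2_set v {..<s} \<le> 1}. F v)"
  proof (rule cSUP_upper)
    \<comment> \<open>A real supremum bounds its set from above only if the set is bounded; the sum
      of all entries of G serves as a bound, as coordinates in the unit ball are at most 1 in
      absolute value.\<close>
    show "bdd_above (F ` {v. L2_set v {..<s} \<le> 1})"
    proof (rule bdd_aboveI2)
      fix v :: "nat \<Rightarrow> real" assume v: "v \<in> {v. L2_set v {..<s} \<le> 1}"
      then have "L2_set (\<lambda>k. \<bar>v k\<bar>) {..<s} \<le> 1"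
        by (simp add: L2_set_def)
      then have "\<bar>v k\<bar> \<le> 1" if "k < s" for k
        using member_le_L2_set[of "{..<s}" k "\<lambda>k. \<bar>v k\<bar>"] that by force
      then have "\<bar>real (G i k) * v k\<bar> \<le> real (G i k)" if "k < s" for i k
        using that by (simp add: abs_mult mult_left_le)
      then have "\<bar>\<Sum>k<s. real (G i k) * v k\<bar> \<le> (\<Sum>k<s. real (G i k))" for i
        by (intro order_trans[OF sum_abs] sum_mono) auto
      then show "F v \<le> (\<Sum>i<r. \<Sum>k<s. real (G i k))"
        unfolding F_def by (intro order_trans[OF L2_set_le_sum_abs] sum_mono)
    qed
  qed (use v in simp)
  finally show ?thesis
    by (simp add: matrix_norm_def F_def)
qed

text \<open>With both sides nonempty, a path joins the distinct vertices \<open>Inl 0\<close> and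
  \<open>Inr 0\<close>, and it must use an edge.\<close>

lemma bratteli_connected_edge:
  assumes "bratteli_connected r s G" "0 < r" "0 < s"
  obtains i j where "i < r" "j < s" "G i j \<noteq> 0"
proof -
  let ?R = "{(Inl i, Inr j) |i j. i < r \<and> j < s \<and> G i j \<noteq> 0} :: ((nat + nat) \<times> (nat + nat)) set"
  have "(Inl 0, Inr 0) \<in> (?R \<union> ?R\<inverse>)\<^sup>*"
    using assms by (auto simp: bratteli_connected_def Let_def)
  then have "?R \<noteq> {}"
    by (metis Inl_Inr_False Un_empty converse_empty rtrancl_empty pair_in_Id_conv)
  then show thesis
    using that by auto
qed

theorem theorem2p2:
  fixes M N :: "'h::complex_hilbert op set"
    and tr :: "'h op \<Rightarrow> complex"
    and E :: "'h op \<Rightarrow> 'h op"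
    and \<eta> :: "'h op \<Rightarrow> 'k::complex_hilbert"
    and lm :: "'h op \<Rightarrow> 'k op"
    and e\<^sub>1 :: "'k op"
    and \<tau> :: real
    and n :: nat
    and l :: "nat \<Rightarrow> 'h op"
  assumes "von_neumann_algebra M" and "von_neumann_algebra N" and "N \<subseteq> M"
    and "fn_tracial_state M tr"
    and "L2_space M tr \<eta> lm"
    and "projection_onto e\<^sub>1 (closure (\<eta> ` N))"
    and "markov_trace M tr lm e\<^sub>1 \<tau>"
    and "case_1 N M lm \<tau> \<or> case_2 N M \<tau>"
    and "conditional_expectation N M tr E"
    and "1 \<le> n"
    and "\<forall>i\<in>{1..n}. l i \<in> M"
  shows "(matrix_projection n N (\<lambda>i j. E (l i o\<^sub>L adj (l j)))
            \<and> matrix_trace n tr (\<lambda>i j. E (l i o\<^sub>L adj (l j))) = complex_of_real (inverse \<tau> / real n)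
            \<longleftrightarrow> (\<Sum>i=1..n. lm (adj (l i)) o\<^sub>L e\<^sub>1 o\<^sub>L lm (l i)) = id_blinfun)
       \<and> ((\<Sum>i=1..n. lm (adj (l i)) o\<^sub>L e\<^sub>1 o\<^sub>L lm (l i)) = id_blinfun
            \<longleftrightarrow> (\<forall>x\<in>M. x = (\<Sum>i=1..n. E (x o\<^sub>L adj (l i)) o\<^sub>L l i)))"
proof -
  interpret J: jones_projection M N tr E \<eta> lm e\<^sub>1
    using assms by unfold_locales
      (auto intro: von_neumann_algebra_imp_star_algebra simp: fn_tracial_state_def)
  have l: "\<And>i. i \<in> {1..n} \<Longrightarrow> l i \<in> M"
    using assms by auto
  \<comment> \<open>Needed for the coupling constant of the image of N, whose orbit of \<xi> has to
    contain \<xi>.\<close>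
  have "id_blinfun \<in> lm ` N"
    using J.lm_id J.N_closed(1) by (auto intro: rev_image_eqI)
  then have "\<tau> \<noteq> 0"
    using assms(8)
  proof (elim disjE)
    assume "case_1 N M lm \<tau>"
    then have "is_coupling_constant (lm ` N) (jones_index N lm)" "\<tau> = 1 / jones_index N lm"
      unfolding case_1_def finite_index_def jones_index_def by (auto intro: someI)
    then show ?thesis
      using coupling_constant_nonzero \<open>id_blinfun \<in> lm ` N\<close> by auto
  next
    assume "case_2 N M \<tau>"
    then obtain r s G where "0 < r" "0 < s" "bratteli_connected r s G" "\<tau> = 1 / (matrix_norm r s G)\<^sup>2"
      unfolding case_2_def inclusion_matrix_def by blast
    \<comment> \<open>As 1 / 0 = 0 by convention, \<tau> vanishes exactly when the matrix norm does;
      an edge of the diagram makes that norm positive.\<close>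
    then show ?thesis
      using bratteli_connected_edge matrix_norm_pos by (metis less_irrefl zero_eq_1_divide_iff zero_eq_power2)
  qed
  obtain Tr where Tr: "positive_trace (basic_construction M lm e\<^sub>1) Tr"
    "\<And>x. x \<in> M \<Longrightarrow> Tr (lm x) = tr x"
    "\<And>x. x \<in> M \<Longrightarrow> Tr (lm x o\<^sub>L e\<^sub>1) = complex_of_real \<tau> * tr x"
    using assms(7) unfolding markov_trace_def by blast
  obtain B where B: "star_algebra B" "insert e\<^sub>1 (lm ` M) \<subseteq> B"
    "B \<subseteq> basic_construction M lm e\<^sub>1"
    unfolding basic_construction_def
    by (rule star_algebra_in_hull[of "insert e\<^sub>1 (lm ` M)"])
      (use J.is_adjoint_e J.e_bounded_ops J.is_adjoint_lm J.lm_bounded_ops in blast)+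
  interpret K: jones_markov M N tr E \<eta> lm e\<^sub>1 \<tau> B Tr
    using B Tr positive_trace_mono[OF Tr(1) B(3)] by unfold_locales auto
  let ?Q = "\<lambda>i j. E (l i o\<^sub>L adj (l j))" and ?T = "J.frame_op {1..n} l"
  \<comment> \<open>The factor 1/n of the normalized matrix trace cancels, and multiplying by \<tau>
    gives the form in which \<open>Tr_frame_op\<close> produces the trace of Q.\<close>
  have trQ: "matrix_trace n tr ?Q = complex_of_real (inverse \<tau> / real n) \<longleftrightarrow>
      complex_of_real \<tau> * (\<Sum>i\<in>{1..n}. tr (?Q i i)) = 1"
    using \<open>\<tau> \<noteq> 0\<close> \<open>1 \<le> n\<close> unfolding matrix_trace_def by (auto simp: field_simps)
  have "matrix_projection n N ?Q \<and> complex_of_real \<tau> * (\<Sum>i\<in>{1..n}. tr (?Q i i)) = 1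
      \<longleftrightarrow> ?T = id_blinfun"
  proof
    assume "matrix_projection n N ?Q \<and> complex_of_real \<tau> * (\<Sum>i\<in>{1..n}. tr (?Q i i)) = 1"
    then show "?T = id_blinfun"
      using \<open>\<tau> \<noteq> 0\<close> unfolding matrix_projection_def by (intro K.frame_op_eq_id l) blast+
  next
    \<comment> \<open>Here \<open>Tr id_blinfun\<close> = 1 gives the trace condition, and the Gram
      lemmas give the projection property.\<close>
    assume T: "?T = id_blinfun"
    then show "matrix_projection n N ?Q \<and> complex_of_real \<tau> * (\<Sum>i\<in>{1..n}. tr (?Q i i)) = 1"
      using K.Tr_frame_op[of "{1..n}" l, OF l] K.Tr_id J.gram_in_N[of "{1..n}" l, OF l]
        J.gram_adj[of "{1..n}" l, OF l] J.gram_idempotent[of "{1..n}" l, OF l T]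
      unfolding matrix_projection_def by simp
  qed
  then show ?thesis
    unfolding trQ using J.frame_op_id_iff_expansion[of "{1..n}" l, OF l]
    unfolding J.frame_op_def by simp
qed

end
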